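(* Let $K \in \mathbb{N}$, $K\ge 1$, and run the generalized Benders algorithm for the $K$-surrogate dual (defined in the context) with tolerance $\epsilon = 0$, i.e. with termination exactly when $\Psi^T = 0$. Denote by $\{(\lambda^t,\Psi^t)\}_{t\ge 1}$ the sequence of values obtained by solving the master problem in the successive iterations $t = 1,2,\dots$ of the algorithm (for any choices of optimal solutions of the sub-problems and master problems). Then either (a) the algorithm terminates in $T$ steps, i.e. $\Psi^T = 0$, in which case $$\max_{1\le t\le T} S^K(\lambda^t) = \sup_{\lambda\in\mathbb{R}^{Km}_+} S^K(\lambda),$$ or (b) the algorithm does not terminate, and $$\sup_{t\ge 1} S^K(\lambda^t) = \sup_{\lambda\in\mathbb{R}^{Km}_+} S^K(\lambda).$$
   Context: Setting. Consider the mixed-integer nonlinear program $$\min\{c^{\mathsf T}x \mid x\in X,\ g_i(x)\le 0 \text{ for all } i\in\mathcal{M}\},\qquad \mathcal{M}=\{1,\dots,m\},$$ where $c\in\mathbb{R}^n$, $X=\{x\in\mathbb{R}^{n-p}\times\mathbb{Z}^p \mid Ax\le b\}$ is a compact mixed-integer linear set, and each $g_i:\mathbb{R}^n\to\mathbb{R}$ is a factorable continuous function (factorable: a finite recursive composition of sums, products and univariate functions). The feasible region of this program is assumed to be nonempty. $K$-surrogate relaxation. For $\mu\in\mathbb{R}^m_+$ let $S_\mu=\{x\in X\mid \sum_{i\in\mathcal{M}}\mu_i g_i(x)\le 0\}$. For $K\in\mathbb{N}$ and $\lambda=(\lambda^{(1)},\dots,\lambda^{(K)})\in\mathbb{R}^{Km}_+$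 with blocks $\lambda^{(k)}\in\mathbb{R}^m_+$, let $S^K_\lambda=\bigcap_{k=1}^K S_{\lambda^{(k)}}$ and $S^K(\lambda)=\min\{c^{\mathsf T}x\mid x\in S^K_\lambda\}$. The $K$-surrogate dual is $\sup_{\lambda\in\mathbb{R}^{Km}_+}S^K(\lambda)$. Algorithm. Set $\lambda^0=0\in\mathbb{R}^{Km}_+$ and $\mathcal{X}^0=\emptyset$. For $t=1,2,\dots$: 1. (Sub-problem) Let $x^t$ be an optimal solution of $\min\{c^{\mathsf T}x\mid x\in S^K_{\lambda^{t-1}}\}$ and set $\mathcal{X}^t=\mathcal{X}^{t-1}\cup\{x^t\}$. 2. (Master problem) Let $(\lambda^t,\Psi^t)$, with $\lambda^t\in\mathbb{R}^{Km}_+$ and $\Psi^t\in\mathbb{R}$, be an optimal solution of $$\max\ \Psi\quad\text{s.t.}\quad \bigvee_{k=1}^K\Big(\sum_{i\in\mathcal{M}}\lambda^{(k)}_i g_i(\bar x)\ge\Psi\Big)\ \text{ for all }\bar x\in\mathcal{X}^t,\qquad \|\lambda^{(k)}\|_1\le 1,\ \lambda^{(k)}\in\mathbb{R}^m_+\ \text{ for all }k\in\{1,\dots,K\},$$ in the variables $\lambda=(\lambda^{(1)},\dots,\lambda^{(K)})$ and $\Psi$; here $\bigvee$ means that at least one of the $K$ inequalities holds. (The optimal value is always $\ge 0$, since $\lambda=0,\Psi=0$ is feasible.) 3. For tolerance $\epsilon=0$: if $\Psi^t=0$, terminate with $T=t$; otherwise continue with $t+1$. *)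

theory Defs
  imports "HOL-Analysis.Analysis"
begin

text \<open>
  Dimensions are carried by finite index types: \<open>'n\<close> for the variables, \<open>'r\<close> for the rows
  of the linear system, \<open>'m\<close> for the nonlinear constraints and \<open>'k\<close> for the \<open>K\<close> blocks of
  multipliers, so that \<open>K = CARD('k)\<close> and a multiplier vector in \<open>\<real>\<^sup>K\<^sup>m\<close> is an element of
  \<open>real ^ 'm ^ 'k\<close>. The order \<open>\<le>\<close> on vectors is componentwise.
\<close>

text \<open>
  \<open>J\<close> is the set of integer coordinates; \<open>\<real>\<^sup>n\<^sup>-\<^sup>p \<times> \<int>\<^sup>p\<close> is the case where \<open>J\<close> consists of
  \<open>p\<close> coordinates, with \<open>J = {}\<close> and \<open>J = UNIV\<close> allowed.
\<close>
definition mixed_integer_set :: "real ^ 'n ^ 'r \<Rightarrow> real ^ 'r \<Rightarrow> 'n set \<Rightarrow> (real ^ 'n) set" where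
  "mixed_integer_set A b J = {x. A *v x \<le> b \<and> (\<forall>j\<in>J. x $ j \<in> \<int>)}"

text \<open>Constants are covered by \<open>univariate\<close> with a constant \<open>\<phi>\<close>.\<close>
inductive factorable :: "(real ^ 'n \<Rightarrow> real) \<Rightarrow> bool" where
  coordinate: "factorable (\<lambda>x. x $ j)"
| sum: "factorable f \<Longrightarrow> factorable h \<Longrightarrow> factorable (\<lambda>x. f x + h x)"
| product: "factorable f \<Longrightarrow> factorable h \<Longrightarrow> factorable (\<lambda>x. f x * h x)"
| univariate: "factorable f \<Longrightarrow> factorable (\<lambda>x. \<phi> (f x))" for \<phi> :: "real \<Rightarrow> real"

definition surrogate_set ::
    "(real ^ 'n) set \<Rightarrow> ('m::finite \<Rightarrow> real ^ 'n \<Rightarrow> real) \<Rightarrow> real ^ 'm \<Rightarrow> (real ^ 'n) set" where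
  "surrogate_set X g \<mu> = {x \<in> X. (\<Sum>i\<in>UNIV. \<mu> $ i * g i x) \<le> 0}"

definition K_surrogate_set ::
    "(real ^ 'n) set \<Rightarrow> ('m::finite \<Rightarrow> real ^ 'n \<Rightarrow> real) \<Rightarrow> real ^ 'm ^ 'k::finite \<Rightarrow> (real ^ 'n) set" where
  "K_surrogate_set X g l = (\<Inter>k. surrogate_set X g (l $ k))"

text \<open>
  Over a nonempty compact set the infimum is the minimum; it is taken in the extended reals so
  that the supremum over all multipliers needs no separate boundedness proviso.
\<close>
definition K_surrogate_value ::
    "real ^ 'n \<Rightarrow> (real ^ 'n) set \<Rightarrow> ('m::finite \<Rightarrow> real ^ 'n \<Rightarrow> real) \<Rightarrow> real ^ 'm ^ 'k::finite \<Rightarrow> ereal" where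
  "K_surrogate_value c X g l = (INF x\<in>K_surrogate_set X g l. ereal (c \<bullet> x))"

definition master_feasible ::
    "('m::finite \<Rightarrow> real ^ 'n \<Rightarrow> real) \<Rightarrow> (real ^ 'n) set \<Rightarrow> (real ^ 'm ^ 'k::finite) \<times> real \<Rightarrow> bool" where
  "master_feasible g C = (\<lambda>(l, \<Psi>).
     (\<forall>x\<in>C. \<exists>k. (\<Sum>i\<in>UNIV. l $ k $ i * g i x) \<ge> \<Psi>) \<and>
     (\<forall>k. (\<Sum>i\<in>UNIV. \<bar>l $ k $ i\<bar>) \<le> 1 \<and> 0 \<le> l $ k))"

text \<open>
  The sequences \<open>x\<close>, \<open>l\<close>, \<open>\<Psi>\<close> record a run of the algorithm with tolerance 0: iteration
  \<open>t\<close> is carried out exactly when no earlier iteration met the termination criterion, and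
  nothing is required of the entries after termination. The set of points collected up to
  iteration \<open>t\<close> is \<open>x ` {1..t}\<close>.
\<close>
definition benders_run ::
    "real ^ 'n \<Rightarrow> (real ^ 'n) set \<Rightarrow> ('m::finite \<Rightarrow> real ^ 'n \<Rightarrow> real) \<Rightarrow>
     (nat \<Rightarrow> real ^ 'n) \<Rightarrow> (nat \<Rightarrow> real ^ 'm ^ 'k::finite) \<Rightarrow> (nat \<Rightarrow> real) \<Rightarrow> bool" where
  "benders_run c X g x l \<Psi> \<longleftrightarrow>
     l 0 = 0 \<and>
     (\<forall>t\<ge>1. (\<forall>s\<in>{1..<t}. \<Psi> s \<noteq> 0) \<longrightarrow>
        is_arg_min (\<lambda>y. c \<bullet> y) (\<lambda>y. y \<in> K_surrogate_set X g (l (t - 1))) (x t) \<and>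
        is_arg_max snd (master_feasible g (x ` {1..t})) (l t, \<Psi> t))"

end

theory Submission
  imports Defs
begin

text \<open>
  A multiplier \<open>\<nu>\<close> may be rescaled so that every block has \<open>1\<close>-norm at most \<open>1\<close>. If it cut off
  all of the collected points by a margin \<open>\<delta> > 0\<close>, then \<open>(\<nu>, \<delta>)\<close> would be feasible for the master
  problem. After termination the optimal value is \<open>0\<close>, so some collected point lies in the surrogate
  set of \<open>\<nu>\<close>, and its objective is the value of an earlier multiplier. Without termination, the
  optimal values come arbitrarily close to \<open>0\<close>: the point \<open>x (t + 1)\<close> satisfies the surrogate
  constraints of \<open>l t\<close>, while each \<open>x s\<close> with \<open>s \<le> t\<close> violates one of them by \<open>\<Psi> t\<close>, so a
  positive lower bound on \<open>\<Psi>\<close> would separate the values of \<open>g\<close> at all iterates, against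
  compactness. Hence some limit point of the iterates lies in the surrogate set of \<open>\<nu>\<close>.
\<close>

section \<open>Surrogate sets and rescaling of multipliers\<close>

lemma mem_K_surrogate_set_iff:
  "y \<in> K_surrogate_set X g \<nu> \<longleftrightarrow> y \<in> X \<and> (\<forall>k. (\<Sum>i\<in>UNIV. \<nu> $ k $ i * g i y) \<le> 0)"
  by (auto simp: K_surrogate_set_def surrogate_set_def)

lemma K_surrogate_set_scaleR:
  assumes "a > 0"
  shows "K_surrogate_set X g (a *\<^sub>R \<nu>) = K_surrogate_set X g \<nu>"
proof -
  have "(\<Sum>i\<in>UNIV. (a *\<^sub>R \<nu>) $ k $ i * g i y) = a * (\<Sum>i\<in>UNIV. \<nu> $ k $ i * g i y)" for k y
    by (simp add: sum_distrib_left mult.assoc)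
  then show ?thesis
    using assms by (auto simp: set_eq_iff mem_K_surrogate_set_iff mult_le_0_iff)
qed

text \<open>These are exactly the constraints of \<open>master_feasible\<close> that do not involve
  the collected points.\<close>

definition normalized_multiplier :: "real ^ 'm ^ 'k::finite \<Rightarrow> bool" where
  "normalized_multiplier \<nu> \<longleftrightarrow> (\<forall>k. (\<Sum>i\<in>UNIV. \<bar>\<nu> $ k $ i\<bar>) \<le> 1 \<and> 0 \<le> \<nu> $ k)"

text \<open>The surrogate constraints are homogeneous in the multiplier with right-hand side 0, so
  division of all blocks by one large constant changes no surrogate set.\<close>

lemma exists_normalized_multiplier:
  fixes \<nu> :: "real ^ 'm ^ 'k::finite"
  assumes "0 \<le> \<nu>"
  obtains \<nu>' :: "real ^ 'm ^ 'k"
  where "normalized_multiplier \<nu>'"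
    "K_surrogate_set X g \<nu>' = K_surrogate_set X g \<nu>"
proof
  \<comment> \<open>The double sum bounds the 1-norm of each block, and the summand 1 keeps
    \<open>M\<close> positive for \<nu> = 0.\<close>
  define M where "M = 1 + (\<Sum>k\<in>UNIV. \<Sum>i\<in>UNIV. \<bar>\<nu> $ k $ i\<bar>)"
  have M: "M > 0"
    unfolding M_def by (smt (verit) abs_ge_zero sum_nonneg)
  show "K_surrogate_set X g ((1 / M) *\<^sub>R \<nu>) = K_surrogate_set X g \<nu>"
    using M by (intro K_surrogate_set_scaleR) simp
  show "normalized_multiplier ((1 / M) *\<^sub>R \<nu>)"
    unfolding normalized_multiplier_def
  proof (intro allI conjI)
    fix k
    have "(\<Sum>i\<in>UNIV. \<bar>\<nu> $ k $ i\<bar>) \<le> (\<Sum>k\<in>UNIV. \<Sum>i\<in>UNIV. \<bar>\<nu> $ k $ i\<bar>)"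
      by (rule member_le_sum[where f = "\<lambda>k. \<Sum>i\<in>UNIV. \<bar>\<nu> $ k $ i\<bar>"]) (auto intro: sum_nonneg)
    then have "(\<Sum>i\<in>UNIV. \<bar>\<nu> $ k $ i\<bar>) \<le> M"
      by (simp add: M_def)
    moreover have "(\<Sum>i\<in>UNIV. \<bar>((1 / M) *\<^sub>R \<nu>) $ k $ i\<bar>) = (\<Sum>i\<in>UNIV. \<bar>\<nu> $ k $ i\<bar>) / M"
      using M by (simp add: sum_divide_distrib abs_mult)
    ultimately show "(\<Sum>i\<in>UNIV. \<bar>((1 / M) *\<^sub>R \<nu>) $ k $ i\<bar>) \<le> 1"
      using M by simp
    show "0 \<le> ((1 / M) *\<^sub>R \<nu>) $ k"
      using M assms by (simp add: less_eq_vec_def)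
  qed
qed

section \<open>Values of surrogate relaxations\<close>

lemma K_surrogate_value_le:
  "y \<in> K_surrogate_set X g \<nu> \<Longrightarrow> K_surrogate_value c X g \<nu> \<le> ereal (c \<bullet> y)"
  unfolding K_surrogate_value_def by (rule INF_lower)

lemma K_surrogate_value_arg_min:
  assumes "is_arg_min (\<lambda>y. c \<bullet> y) (\<lambda>y. y \<in> K_surrogate_set X g \<nu>) z"
  shows "K_surrogate_value c X g \<nu> = ereal (c \<bullet> z)"
  using assms unfolding K_surrogate_value_def is_arg_min_def
  by (intro antisym INF_lower INF_greatest) (auto simp: not_less)

text \<open>The zero multiplier cuts off nothing from \<open>X\<close>. This disposes of the initial
  multiplier \<open>l 0\<close>, which is not among the values compared in the theorem.\<close>

lemma K_surrogate_value_zero_le: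
  "K_surrogate_value c X g 0 \<le> K_surrogate_value c X g \<nu>"
  unfolding K_surrogate_value_def
  by (rule INF_superset_mono) (auto simp: mem_K_surrogate_set_iff)

section \<open>The master problem\<close>

lemma master_optimal_lessE:
  fixes \<mu> \<nu> :: "real ^ 'm ^ 'k::finite"
  assumes opt: "is_arg_max snd (master_feasible g C) (\<mu>, \<psi>)"
    and "\<psi> < \<delta>" and "normalized_multiplier \<nu>"
  obtains y where "y \<in> C" "\<And>k. (\<Sum>i\<in>UNIV. \<nu> $ k $ i * g i y) < \<delta>"
proof -
  \<comment> \<open>Feasibility would contradict optimality; as \<nu> is normalized, what fails must
    be the disjunction at some collected point.\<close>
  have "\<not> master_feasible g C (\<nu>, \<delta>)"
    using opt \<open>\<psi> < \<delta>\<close> unfolding is_arg_max_def by force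
  then show ?thesis
    using assms(3) that unfolding master_feasible_def normalized_multiplier_def by (auto simp: not_le)
qed

text \<open>If \<nu> cut off every point of \<open>C\<close>, each would violate some block by a
  positive amount. The least of these finitely many amounts is a positive margin, which optimality
  of 0 forbids.\<close>

lemma master_zero_obtains_uncut:
  fixes \<mu> \<nu> :: "real ^ 'm ^ 'k::finite"
  assumes opt: "is_arg_max snd (master_feasible g C) (\<mu>, 0)"
    and "normalized_multiplier \<nu>" and "finite C"
  obtains y where "y \<in> C" "\<And>k. (\<Sum>i\<in>UNIV. \<nu> $ k $ i * g i y) \<le> 0"
proof -
  have "\<exists>y\<in>C. \<forall>k. (\<Sum>i\<in>UNIV. \<nu> $ k $ i * g i y) \<le> 0"
  proof (rule ccontr)
    assume "\<not> ?thesis"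
    then obtain \<kappa> where \<kappa>: "\<And>y. y \<in> C \<Longrightarrow> (\<Sum>i\<in>UNIV. \<nu> $ \<kappa> y $ i * g i y) > 0"
      by (metis not_le)
    \<comment> \<open>The inserted 1 makes the minimum meaningful for empty
      \<open>C\<close>.\<close>
    define \<delta> where "\<delta> = Min (insert 1 ((\<lambda>y. \<Sum>i\<in>UNIV. \<nu> $ \<kappa> y $ i * g i y) ` C))"
    have "\<delta> > 0"
      using \<open>finite C\<close> \<kappa> by (auto simp: \<delta>_def)
    from master_optimal_lessE[OF opt this \<open>normalized_multiplier \<nu>\<close>]
    obtain y where y: "y \<in> C" "\<And>k. (\<Sum>i\<in>UNIV. \<nu> $ k $ i * g i y) < \<delta>"
      by blast
    have "\<delta> \<le> (\<Sum>i\<in>UNIV. \<nu> $ \<kappa> y $ i * g i y)"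
      using \<open>finite C\<close> y(1) by (auto simp: \<delta>_def intro: Min_le)
    with y(2)[of "\<kappa> y"] show False
      by simp
  qed
  then show ?thesis
    using that by blast
qed

text \<open>Some block of \<mu> is at least \<psi> at \<open>y\<close> and at most 0 at
  \<open>z\<close>. Since its 1-norm is at most 1, it cannot change by more than the distance
  between the two vectors of constraint values.\<close>

lemma master_value_le_dist:
  fixes g :: "'m::finite \<Rightarrow> real ^ 'n \<Rightarrow> real"
  assumes feas: "master_feasible g C (\<mu>, \<psi>)" and "y \<in> C" and z: "z \<in> K_surrogate_set X g \<mu>"
  shows "\<psi> \<le> dist (\<chi> i. g i y) (\<chi> i. g i z)"
proof -
  let ?d = "dist (\<chi> i. g i y) (\<chi> i. g i z)"
  obtain k where k: "\<psi> \<le> (\<Sum>i\<in>UNIV. \<mu> $ k $ i * g i y)"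
    using feas \<open>y \<in> C\<close> unfolding master_feasible_def by auto
  have norm: "(\<Sum>i\<in>UNIV. \<bar>\<mu> $ k $ i\<bar>) \<le> 1" and "0 \<le> \<mu> $ k"
    using feas unfolding master_feasible_def by blast+
  then have nonneg: "0 \<le> \<mu> $ k $ i" for i
    by (simp add: less_eq_vec_def)
  have diff: "g i y - g i z \<le> ?d" for i
    using dist_vec_nth_le[of "\<chi> i. g i y" i "\<chi> i. g i z"] by (simp add: dist_real_def)
  have "\<psi> \<le> (\<Sum>i\<in>UNIV. \<mu> $ k $ i * g i y) - (\<Sum>i\<in>UNIV. \<mu> $ k $ i * g i z)"
    using k z[unfolded mem_K_surrogate_set_iff, THEN conjunct2, rule_format, of k] by linarith
  also have "\<dots> = (\<Sum>i\<in>UNIV. \<mu> $ k $ i * (g i y - g i z))"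
    by (simp add: sum_subtractf right_diff_distrib)
  also have "\<dots> \<le> (\<Sum>i\<in>UNIV. \<mu> $ k $ i * ?d)"
    by (intro sum_mono mult_left_mono diff nonneg)
  also have "\<dots> = (\<Sum>i\<in>UNIV. \<bar>\<mu> $ k $ i\<bar>) * ?d"
    using nonneg by (simp add: sum_distrib_right)
  also have "\<dots> \<le> 1 * ?d"
    by (intro mult_right_mono norm) simp
  finally show ?thesis by simp
qed

section \<open>Runs of the algorithm\<close>

lemma benders_run_step:
  assumes "benders_run c X g x l \<Psi>" "t \<ge> 1" "\<forall>s\<in>{1..<t}. \<Psi> s \<noteq> 0"
  shows "is_arg_min (\<lambda>y. c \<bullet> y) (\<lambda>y. y \<in> K_surrogate_set X g (l (t - 1))) (x t)"
    and "is_arg_max snd (master_feasible g (x ` {1..t})) (l t, \<Psi> t)"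
  using assms unfolding benders_run_def by blast+

lemma benders_run_nonneg:
  assumes "benders_run c X g x l \<Psi>" "t \<ge> 1" "\<forall>s\<in>{1..<t}. \<Psi> s \<noteq> 0"
  shows "0 \<le> l t"
  using benders_run_step(2)[OF assms]
  by (simp add: is_arg_max_def master_feasible_def less_eq_vec_def)

text \<open>The vectors of constraint values at the iterates lie in a compact set, so two of them
  are within \<delta>. The earlier iterate is already collected when the master problem just before
  the later one is solved, and \<open>master_value_le_dist\<close> applies to the pair.\<close>

lemma benders_run_master_small:
  fixes g :: "'m::finite \<Rightarrow> real ^ 'n \<Rightarrow> real"
  assumes run: "benders_run c X g x l \<Psi>" and nz: "\<forall>t\<ge>1. \<Psi> t \<noteq> 0"
    and "compact X" and cont: "\<And>i. continuous_on X (g i)" and "\<delta> > 0"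
  obtains t where "t \<ge> 1" "\<Psi> t < \<delta>"
proof -
  let ?G = "\<lambda>y. \<chi> i. g i y"
  have x: "x (Suc n) \<in> K_surrogate_set X g (l n)" for n
    using benders_run_step(1)[OF run, of "Suc n"] nz by (simp add: is_arg_min_def)
  have "compact (?G ` X)"
    by (intro compact_continuous_image \<open>compact X\<close> continuous_on_vec_lambda cont)
  moreover have "\<forall>n. ?G (x (Suc n)) \<in> ?G ` X"
    using x by (auto simp: mem_K_surrogate_set_iff)
  ultimately obtain r a where "strict_mono r" and lim: "((\<lambda>n. ?G (x (Suc n))) \<circ> r) \<longlonglongrightarrow> a"
    unfolding compact_eq_seq_compact_metric by (rule seq_compactE)
  obtain N where N: "\<And>m n. m \<ge> N \<Longrightarrow> n \<ge> N \<Longrightarrow> dist (?G (x (Suc (r m)))) (?G (x (Suc (r n)))) < \<delta>"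
    using LIMSEQ_imp_Cauchy[OF lim] \<open>\<delta> > 0\<close> unfolding Cauchy_def o_def by blast
  \<comment> \<open>The shift by one matters: the close iterates are \<open>x s\<close> and
    \<open>x (Suc t)\<close>, with \<open>s \<le> t\<close> because \<open>r\<close> is strictly
    increasing, and \<open>x (Suc t)\<close> solves the sub-problem for \<open>l t\<close>.\<close>
  define s where "s = Suc (r N)"
  define t where "t = r (Suc N)"
  have "s \<le> t"
    using \<open>strict_mono r\<close> by (simp add: s_def t_def Suc_le_eq strict_mono_Suc_iff)
  moreover have "s \<ge> 1"
    by (simp add: s_def)
  ultimately have "t \<ge> 1" "x s \<in> x ` {1..t}"
    by auto
  moreover have "master_feasible g (x ` {1..t}) (l t, \<Psi> t)"
    using benders_run_step(2)[OF run \<open>t \<ge> 1\<close>] nz by (simp add: is_arg_max_def)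
  ultimately have "\<Psi> t \<le> dist (?G (x s)) (?G (x (Suc t)))"
    using master_value_le_dist x by blast
  also have "\<dots> < \<delta>"
    using N[of N "Suc N"] by (simp add: s_def t_def)
  finally show ?thesis
    using that \<open>t \<ge> 1\<close> by blast
qed

text \<open>A collected point that \<nu> does not cut off bounds the value of \<nu> from above.
  Being optimal for the preceding sub-problem, it attains the value of that multiplier.\<close>

lemma benders_run_terminating_bound:
  fixes g :: "'m::finite \<Rightarrow> real ^ 'n \<Rightarrow> real"
    and l :: "nat \<Rightarrow> real ^ 'm ^ 'k::finite" and \<nu> :: "real ^ 'm ^ 'k"
  assumes run: "benders_run c X g x l \<Psi>" and T: "T \<ge> 1" "\<forall>t\<in>{1..<T}. \<Psi> t \<noteq> 0" "\<Psi> T = 0"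
    and "0 \<le> \<nu>"
  shows "\<exists>t\<in>{1..T}. K_surrogate_value c X g \<nu> \<le> K_surrogate_value c X g (l t)"
proof -
  obtain \<nu>' :: "real ^ 'm ^ 'k" where \<nu>': "normalized_multiplier \<nu>'"
    and eq: "K_surrogate_set X g \<nu>' = K_surrogate_set X g \<nu>"
    using \<open>0 \<le> \<nu>\<close> by (rule exists_normalized_multiplier)
  have "is_arg_max snd (master_feasible g (x ` {1..T})) (l T, 0)"
    using benders_run_step(2)[OF run T(1,2)] T(3) by simp
  then obtain y where "y \<in> x ` {1..T}" and y: "\<And>k. (\<Sum>i\<in>UNIV. \<nu>' $ k $ i * g i y) \<le> 0"
    using \<nu>' by (rule master_zero_obtains_uncut) auto
  then obtain s where s: "s \<in> {1..T}" "y = x s"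
    by auto
  have min: "is_arg_min (\<lambda>y. c \<bullet> y) (\<lambda>y. y \<in> K_surrogate_set X g (l (s - 1))) y"
    using benders_run_step(1)[OF run, of s] s T(2) by simp
  then have "y \<in> X"
    by (simp add: is_arg_min_def mem_K_surrogate_set_iff)
  then have "K_surrogate_value c X g \<nu> \<le> ereal (c \<bullet> y)"
    using y by (intro K_surrogate_value_le) (simp add: mem_K_surrogate_set_iff flip: eq)
  then have le: "K_surrogate_value c X g \<nu> \<le> K_surrogate_value c X g (l (s - 1))"
    using K_surrogate_value_arg_min[OF min] by simp
  show ?thesis
  \<comment> \<open>For \<open>s = 1\<close> the preceding multiplier is \<open>l 0 = 0\<close>,
    outside the range; its value is at most that of \<open>l T\<close>.\<close>
  proof (cases "s = 1")
    case True
    then have "l (s - 1) = 0"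
      using run by (simp add: benders_run_def)
    then have "K_surrogate_value c X g \<nu> \<le> K_surrogate_value c X g (l T)"
      using le K_surrogate_value_zero_le by (metis order_trans)
    then show ?thesis
      using T(1) by auto
  next
    case False
    then show ?thesis
      using s le by (intro bexI[of _ "s - 1"]) auto
  qed
qed

text \<open>Some iterates violate \<nu> by arbitrarily little, so a limit point of them satisfies
  it. All iterates have objective at most the supremum, and this bound passes to the limit.\<close>

lemma benders_run_nonterminating_bound:
  fixes g :: "'m::finite \<Rightarrow> real ^ 'n \<Rightarrow> real"
    and l :: "nat \<Rightarrow> real ^ 'm ^ 'k::finite" and \<nu> :: "real ^ 'm ^ 'k"
  assumes run: "benders_run c X g x l \<Psi>" and nz: "\<forall>t\<ge>1. \<Psi> t \<noteq> 0"
    and "compact X" and cont: "\<And>i. continuous_on X (g i)" and "0 \<le> \<nu>"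
  shows "K_surrogate_value c X g \<nu> \<le> (SUP t\<in>{1..}. K_surrogate_value c X g (l t))"
    (is "_ \<le> ?S")
proof -
  obtain \<nu>' :: "real ^ 'm ^ 'k" where \<nu>': "normalized_multiplier \<nu>'"
    and eq: "K_surrogate_set X g \<nu>' = K_surrogate_set X g \<nu>"
    using \<open>0 \<le> \<nu>\<close> by (rule exists_normalized_multiplier)
  let ?h = "\<lambda>k y. \<Sum>i\<in>UNIV. \<nu>' $ k $ i * g i y"
  have min: "is_arg_min (\<lambda>y. c \<bullet> y) (\<lambda>y. y \<in> K_surrogate_set X g (l (s - 1))) (x s)"
    if "s \<ge> 1" for s
    using benders_run_step(1)[OF run that] nz by simp
  have x: "x s \<in> X" "ereal (c \<bullet> x s) \<le> ?S" if "s \<ge> 1" for s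
  proof -
    show "x s \<in> X"
      using min[OF that] by (simp add: is_arg_min_def mem_K_surrogate_set_iff)
    have "K_surrogate_value c X g (l (s - 1)) \<le> ?S"
    proof (cases "s = 1")
      case True
      then have "l (s - 1) = 0"
        using run by (simp add: benders_run_def)
      then have "K_surrogate_value c X g (l (s - 1)) \<le> K_surrogate_value c X g (l 1)"
        by (simp add: K_surrogate_value_zero_le)
      also have "\<dots> \<le> ?S"
        by (intro SUP_upper) simp
      finally show ?thesis .
    next
      case False
      with that show ?thesis
        by (intro SUP_upper) simp
    qed
    then show "ereal (c \<bullet> x s) \<le> ?S"
      using K_surrogate_value_arg_min[OF min[OF that]] by simp
  qed
  \<comment> \<open>Once the master value drops below \<delta>, the normalized multiplier cannot cut
    off all collected points by \<delta>.\<close>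
  have "\<exists>s\<ge>1. \<forall>k. ?h k (x s) < \<delta>" if "\<delta> > 0" for \<delta>
  proof -
    obtain t where t: "t \<ge> 1" "\<Psi> t < \<delta>"
      using benders_run_master_small[OF run nz \<open>compact X\<close> cont \<open>\<delta> > 0\<close>] by blast
    obtain y where "y \<in> x ` {1..t}" "\<And>k. ?h k y < \<delta>"
      using master_optimal_lessE[OF benders_run_step(2)[OF run t(1)] t(2) \<nu>'] nz by auto
    then show ?thesis
      by auto
  qed
  then have "\<exists>s. s \<ge> 1 \<and> (\<forall>k. ?h k (x s) < inverse (real (Suc n)))" for n
    by simp
  then obtain s where s: "\<And>n. s n \<ge> 1" "\<And>n k. ?h k (x (s n)) < inverse (real (Suc n))"
    by metis
  \<comment> \<open>The indices \<open>s n\<close> may repeat or decrease; only membership of the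
    points in \<open>X\<close> and the vanishing bounds matter.\<close>
  have "seq_compact X" "\<forall>n. x (s n) \<in> X"
    using \<open>compact X\<close> x(1)[OF s(1)] by (auto simp: compact_eq_seq_compact_metric)
  then obtain a r where "a \<in> X" "strict_mono r" and "((\<lambda>n. x (s n)) \<circ> r) \<longlonglongrightarrow> a"
    by (rule seq_compactE)
  then have lim: "(\<lambda>n. x (s (r n))) \<longlonglongrightarrow> a"
    by (simp add: o_def)
  have "?h k a \<le> 0" for k
  proof (rule LIMSEQ_le)
    have "(\<lambda>n. g i (x (s (r n)))) \<longlonglongrightarrow> g i a" for i
      using continuous_on_tendsto_compose[OF cont lim \<open>a \<in> X\<close>] x(1)[OF s(1)] by simp
    then show "(\<lambda>n. ?h k (x (s (r n)))) \<longlonglongrightarrow> ?h k a"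
      by (intro tendsto_intros)
    show "(\<lambda>n. inverse (real (Suc (r n)))) \<longlonglongrightarrow> 0"
      using LIMSEQ_subseq_LIMSEQ[OF LIMSEQ_inverse_real_of_nat \<open>strict_mono r\<close>] by (simp add: o_def)
    show "\<exists>N. \<forall>n\<ge>N. ?h k (x (s (r n))) \<le> inverse (real (Suc (r n)))"
      using s(2) less_imp_le by blast
  qed
  then have "K_surrogate_value c X g \<nu> \<le> ereal (c \<bullet> a)"
    using \<open>a \<in> X\<close> by (intro K_surrogate_value_le) (simp add: mem_K_surrogate_set_iff flip: eq)
  also have "\<dots> \<le> ?S"
  proof (rule LIMSEQ_le_const2)
    show "(\<lambda>n. ereal (c \<bullet> x (s (r n)))) \<longlonglongrightarrow> ereal (c \<bullet> a)"
      by (intro tendsto_intros lim)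
    show "\<exists>N. \<forall>n\<ge>N. ereal (c \<bullet> x (s (r n))) \<le> ?S"
      using x(2) s(1) by blast
  qed
  finally show ?thesis .
qed

section \<open>Convergence to the dual value with and without termination\<close>

theorem theorem3:
  fixes c :: "real ^ 'n"
    and A :: "real ^ 'n ^ 'r" and b :: "real ^ 'r" and J :: "'n set"
    and g :: "'m::finite \<Rightarrow> real ^ 'n \<Rightarrow> real"
    and X :: "(real ^ 'n) set"
    and x :: "nat \<Rightarrow> real ^ 'n"
    and l :: "nat \<Rightarrow> real ^ 'm ^ 'k::finite"
    and \<Psi> :: "nat \<Rightarrow> real"
  assumes X_def: "X = mixed_integer_set A b J"
    and X_compact: "compact X"
    and g_factorable: "\<And>i. factorable (g i)"
    and g_continuous: "\<And>i. continuous_on UNIV (g i)"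
    and feasible: "{y \<in> X. \<forall>i. g i y \<le> 0} \<noteq> {}"
    and run: "benders_run c X g x l \<Psi>"
  shows "(\<exists>T\<ge>1. (\<forall>t\<in>{1..<T}. \<Psi> t \<noteq> 0) \<and> \<Psi> T = 0 \<and>
            (MAX t\<in>{1..T}. K_surrogate_value c X g (l t))
              = (SUP \<nu>\<in>{\<nu> :: real ^ 'm ^ 'k. 0 \<le> \<nu>}. K_surrogate_value c X g \<nu>))
       \<or> ((\<forall>t\<ge>1. \<Psi> t \<noteq> 0) \<and>
            (SUP t\<in>{1..}. K_surrogate_value c X g (l t))
              = (SUP \<nu>\<in>{\<nu> :: real ^ 'm ^ 'k. 0 \<le> \<nu>}. K_surrogate_value c X g \<nu>))"
proof (cases "\<exists>T\<ge>1. \<Psi> T = 0")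
  case True
  \<comment> \<open>The first zero of \<Psi> is taken, since a run constrains no entries after
    it.\<close>
  define T where "T = (LEAST T. T \<ge> 1 \<and> \<Psi> T = 0)"
  have "T \<ge> 1 \<and> \<Psi> T = 0"
    using True unfolding T_def by (metis (mono_tags, lifting) LeastI_ex)
  moreover have nz: "\<forall>t\<in>{1..<T}. \<Psi> t \<noteq> 0"
    unfolding T_def by (auto dest: not_less_Least)
  ultimately have T: "T \<ge> 1" "\<forall>t\<in>{1..<T}. \<Psi> t \<noteq> 0" "\<Psi> T = 0"
    by auto
  have "(MAX t\<in>{1..T}. K_surrogate_value c X g (l t)) =
      (SUP \<nu>\<in>{\<nu> :: real ^ 'm ^ 'k. 0 \<le> \<nu>}. K_surrogate_value c X g \<nu>)"
  proof (rule antisym)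
    \<comment> \<open>Master solutions are nonnegative, hence admissible in the dual; this gives the
      easy inequality.\<close>
    have "0 \<le> l t" if "t \<in> {1..T}" for t
      using benders_run_nonneg[OF run] that nz by auto
    then show "(MAX t\<in>{1..T}. K_surrogate_value c X g (l t)) \<le>
        (SUP \<nu>\<in>{\<nu> :: real ^ 'm ^ 'k. 0 \<le> \<nu>}. K_surrogate_value c X g \<nu>)"
      using T(1) by (auto intro: SUP_upper)
    show "(SUP \<nu>\<in>{\<nu> :: real ^ 'm ^ 'k. 0 \<le> \<nu>}. K_surrogate_value c X g \<nu>) \<le>
        (MAX t\<in>{1..T}. K_surrogate_value c X g (l t))"
      using benders_run_terminating_bound[OF run T] T(1)
      by (intro SUP_least) (simp add: Max_ge_iff)
  qed
  with T show ?thesis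
    by blast
next
  case False
  then have nz: "\<forall>t\<ge>1. \<Psi> t \<noteq> 0"
    by blast
  have "(SUP t\<in>{1..}. K_surrogate_value c X g (l t)) =
      (SUP \<nu>\<in>{\<nu> :: real ^ 'm ^ 'k. 0 \<le> \<nu>}. K_surrogate_value c X g \<nu>)"
  proof (rule antisym)
    have "0 \<le> l t" if "t \<ge> 1" for t
      using benders_run_nonneg[OF run that] nz by auto
    then show "(SUP t\<in>{1..}. K_surrogate_value c X g (l t)) \<le>
        (SUP \<nu>\<in>{\<nu> :: real ^ 'm ^ 'k. 0 \<le> \<nu>}. K_surrogate_value c X g \<nu>)"
      by (intro SUP_mono) auto
    have "continuous_on X (g i)" for i
      using g_continuous by (rule continuous_on_subset) simp
    from benders_run_nonterminating_bound[OF run nz X_compact this]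
    show "(SUP \<nu>\<in>{\<nu> :: real ^ 'm ^ 'k. 0 \<le> \<nu>}. K_surrogate_value c X g \<nu>) \<le>
        (SUP t\<in>{1..}. K_surrogate_value c X g (l t))"
      by (intro SUP_least) simp
  qed
  with nz show ?thesis
    by blast
qed

end
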